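(* Let $X$ be a UMD space, let $T>0$ and let $\tau=T/N$ with $N$ a positive integer. Let $\bar\partial_\tau^\alpha v^n=\frac1{\tau^\alpha}\sum_{j=0}^nK_{n-j}v^j$ denote either the L1 scheme or the convolution quadrature generated by the $k$-th order backward difference formula (BDF), with $1\le k\le6$. Then the discrete fractional Gronwall inequality holds: if $\alpha\in(0,1)$ and $p\in(1/\alpha,\infty)$, and a sequence $v^n\in X$, $n=0,1,2,\dots$, with $v^0=0$, satisfies $$\|(\bar\partial_\tau^\alpha v^n)_{n=1}^m\|_{\ell^p(X)}\le\kappa\|(v^n)_{n=1}^m\|_{\ell^p(X)}+\sigma,\qquad\forall\,1\le m\le N,$$ for some positive constants $\kappa$ and $\sigma$, then there exists a $\tau_0>0$ such that for any $\tau<\tau_0$ there holds $$\|(v^n)_{n=1}^N\|_{\ell^\infty(X)}+\|(\bar\partial_\tau^\alpha v^n)_{n=1}^N\|_{\ell^p(X)}\le c\,\sigma,$$ where the constants $c$ and $\tau_0$ are independent of $\sigma$, $\tau$, $N$ and $v^n$, but may depend on $\alpha$, $p$, $\kappa$, $X$ and $T$.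
   Context: The weights $K_j$ are defined by power series expansions at $\zeta=0$. For the convolution quadrature generated by the $k$-th order BDF: $\big(\sum_{j=1}^k\frac1j(1-\zeta)^j\big)^\alpha=\sum_{j=0}^\infty K_j\zeta^j$ (branch positive at $\zeta=0$). For the L1 scheme: $\frac{(1-\zeta)^2}{\zeta\,\Gamma(2-\alpha)}\mathrm{Li}_{\alpha-1}(\zeta)=\sum_{j=0}^\infty K_j\zeta^j$, where $\mathrm{Li}_p(z)=\sum_{j=1}^\infty z^j/j^p$ for $|z|<1$ is the polylogarithm. A UMD space is a Banach space $X$ such that the Hilbert transform $Hf(t)=\int_{\mathbb R}\frac{f(s)}{t-s}\,\mathrm ds$ (principal value) is bounded on $L^p(\mathbb R;X)$ for all $1<p<\infty$. For a finite sequence in $X$, the norms are $\|(v^n)_{n=1}^m\|_{\ell^p(X)}=\big(\sum_{n=1}^m\tau\|v^n\|_X^p\big)^{1/p}$ for $1\le p<\infty$ and $\|(v^n)_{n=1}^m\|_{\ell^\infty(X)}=\max_{1\le n\le m}\|v^n\|_X$. *)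

theory Defs
  imports "HOL-Analysis.Analysis"
begin

section \<open>Convolution weights\<close>

text \<open>Punctured disc: the L1 generating function below has a removable singularity at \<open>0\<close>, where its
  HOL expression takes the junk value \<open>0\<close>. The weights are still uniquely determined.\<close>

definition expands_at_0 :: "(complex \<Rightarrow> complex) \<Rightarrow> (nat \<Rightarrow> real) \<Rightarrow> bool" where
  "expands_at_0 F K \<longleftrightarrow>
     (\<exists>r>0. \<forall>\<zeta>. 0 < norm \<zeta> \<and> norm \<zeta> < r \<longrightarrow> (\<lambda>j. of_real (K j) * \<zeta> ^ j) sums F \<zeta>)"

text \<open>The principal power is the branch that is positive at \<open>\<zeta> = 0\<close>, since the base is positive there.\<close>

definition bdf_gen :: "nat \<Rightarrow> real \<Rightarrow> complex \<Rightarrow> complex" where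
  "bdf_gen k \<alpha> \<zeta> = (\<Sum>j=1..k. (1 / of_nat j) * (1 - \<zeta>) ^ j) powr of_real \<alpha>"

text \<open>Meaningful for \<open>norm z < 1\<close>.\<close>

definition polylog :: "real \<Rightarrow> complex \<Rightarrow> complex" where
  "polylog p z = (\<Sum>j. z ^ Suc j / of_real (real (Suc j) powr p))"

definition l1_gen :: "real \<Rightarrow> complex \<Rightarrow> complex" where
  "l1_gen \<alpha> \<zeta> = (1 - \<zeta>)\<^sup>2 / (\<zeta> * of_real (Gamma (2 - \<alpha>))) * polylog (\<alpha> - 1) \<zeta>"

definition scheme_weights :: "real \<Rightarrow> (nat \<Rightarrow> real) \<Rightarrow> bool" where
  "scheme_weights \<alpha> K \<longleftrightarrow>
     expands_at_0 (l1_gen \<alpha>) K \<or> (\<exists>k\<in>{1..6}. expands_at_0 (bdf_gen k \<alpha>) K)"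

definition frac_diff ::
  "(nat \<Rightarrow> real) \<Rightarrow> real \<Rightarrow> real \<Rightarrow> (nat \<Rightarrow> 'x::real_normed_vector) \<Rightarrow> nat \<Rightarrow> 'x" where
  "frac_diff K \<alpha> \<tau> v n = (1 / \<tau> powr \<alpha>) *\<^sub>R (\<Sum>j=0..n. K (n - j) *\<^sub>R v j)"


section \<open>Discrete norms\<close>

definition seq_lp_norm :: "real \<Rightarrow> real \<Rightarrow> nat \<Rightarrow> (nat \<Rightarrow> 'x::real_normed_vector) \<Rightarrow> real" where
  "seq_lp_norm \<tau> p m v = (\<Sum>n=1..m. \<tau> * norm (v n) powr p) powr (1 / p)"

definition seq_linf_norm :: "nat \<Rightarrow> (nat \<Rightarrow> 'x::real_normed_vector) \<Rightarrow> real" where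
  "seq_linf_norm m v = Max ((\<lambda>n. norm (v n)) ` {1..m})"


section \<open>UMD spaces\<close>

text \<open>The Bochner integral of HOL-Analysis is restricted to second countable (separable) spaces, so the
  Bochner spaces are set up here for arbitrary Banach spaces. Strong measurability is a.e.
  approximability by simple functions. The vector-valued integrals that occur are of strongly
  measurable functions with integrable norm, for which the Henstock--Kurzweil integral exists and
  agrees with the Bochner integral.\<close>

definition strongly_measurable :: "(real \<Rightarrow> 'x::real_normed_vector) \<Rightarrow> bool" where
  "strongly_measurable f \<longleftrightarrow>
     (\<exists>s. (\<forall>i::nat. simple_function lebesgue (s i)) \<and> (AE t in lebesgue. (\<lambda>i. s i t) \<longlonglongrightarrow> f t))"

definition Lp_space :: "real \<Rightarrow> (real \<Rightarrow> 'x::real_normed_vector) set" where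
  "Lp_space p = {f. strongly_measurable f \<and> integrable lebesgue (\<lambda>t. norm (f t) powr p)}"

definition Lp_norm :: "real \<Rightarrow> (real \<Rightarrow> 'x::real_normed_vector) \<Rightarrow> real" where
  "Lp_norm p f = (LINT t|lebesgue. norm (f t) powr p) powr (1 / p)"

definition truncated_hilbert :: "real \<Rightarrow> (real \<Rightarrow> 'x::real_normed_vector) \<Rightarrow> real \<Rightarrow> 'x" where
  "truncated_hilbert \<epsilon> f t = integral {s. \<epsilon> < \<bar>t - s\<bar>} (\<lambda>s. (1 / (t - s)) *\<^sub>R f s)"

text \<open>\<open>g\<close> is the Hilbert transform of \<open>f\<close>: the principal value exists almost everywhere and equals \<open>g\<close>.\<close>

definition is_hilbert_transform ::
  "(real \<Rightarrow> 'x::real_normed_vector) \<Rightarrow> (real \<Rightarrow> 'x) \<Rightarrow> bool" where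
  "is_hilbert_transform f g \<longleftrightarrow>
     (AE t in lebesgue. ((\<lambda>\<epsilon>. truncated_hilbert \<epsilon> f t) \<longlongrightarrow> g t) (at_right 0))"

definition umd_space :: "'x::banach itself \<Rightarrow> bool" where
  "umd_space _ \<longleftrightarrow>
     (\<forall>p>1. \<exists>C. \<forall>f \<in> (Lp_space p :: (real \<Rightarrow> 'x) set).
        \<exists>g \<in> Lp_space p. is_hilbert_transform f g \<and> Lp_norm p g \<le> C * Lp_norm p f)"

end

theory Submission
  imports Defs "HOL-Complex_Analysis.Complex_Analysis"
begin

text \<open>The discrete fractional derivative is, up to the factor \<open>\<tau> powr -\<alpha>\<close>, a convolution with the weights \<open>K\<close>.
  Its inverse is therefore \<open>\<tau> powr \<alpha>\<close> times the convolution with the coefficients \<open>b\<close> of the reciprocal power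
  series, a discrete fractional integral. Everything rests on the fact that \<open>b\<close> decays like the kernel of the
  continuous fractional integral, \<open>\<bar>b n\<bar> \<le> C * (n + 1) powr (\<alpha> - 1)\<close>
  (\<open>scheme_inverse_weights_bound\<close>). Since \<open>p > 1 / \<alpha>\<close>, the kernel \<open>n powr (\<alpha> - 1)\<close> is \<open>q\<close>-summable up to \<open>N\<close>
  with a sum of order \<open>N powr (1 - (1 - \<alpha>) * q)\<close> for the conjugate exponent \<open>q\<close>, and Hoelder's inequality
  turns the decay into the discrete Sobolev embedding
  \<open>norm (v n) \<le> A * seq_lp_norm \<tau> p n (frac_diff K \<alpha> \<tau> v)\<close>, in which all powers of \<open>\<tau>\<close> combine to
  \<open>(\<tau> * n) powr (\<alpha> - 1 / p)\<close> (\<open>sup_le_frac_diff_lp\<close>). The hypothesis of the theorem now gives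
  \<open>norm (v n) \<le> A * (\<kappa> * seq_lp_norm \<tau> p n v + \<sigma>)\<close> for every \<open>n \<le> N\<close>, and the \<open>p\<close>-th power of this is an
  ordinary discrete Gronwall inequality for the partial sums of \<open>\<tau> * norm (v n) powr p\<close>
  (\<open>lp_gronwall\<close>). The threshold \<open>\<tau>\<^sub>0\<close> serves to absorb the newest term of that sum. In this way the
  triangle inequality in \<open>X\<close> reduces the vector-valued problem to scalar kernels.\<close>

text \<open>The decay of \<open>b\<close> is proved differently for the two families of schemes.
  
  For the L1 scheme, \<open>(1 - \<zeta>)\<^sup>2 / \<zeta> * polylog (\<alpha> - 1) \<zeta> = (1 - \<zeta>) * (\<Sum>n. a n * \<zeta> ^ n)\<close> with
  \<open>a n = (n + 1) powr (1 - \<alpha>) - n powr (1 - \<alpha>)\<close>. This sequence is positive and log-convex, so by Kaluza's theorem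
  the reciprocal of its generating function has nonpositive coefficients after the first. Hence \<open>b\<close>, whose
  increments are these coefficients up to a factor, is decreasing. It is also nonnegative, and
  \<open>(\<Sum>i\<le>n. b i * a (n - i)) = Gamma (2 - \<alpha>)\<close> for all \<open>n\<close>. Replacing \<open>b i\<close> by its minimum \<open>b n\<close> leaves a telescoping sum
  and gives \<open>b n * (n + 1) powr (1 - \<alpha>) \<le> Gamma (2 - \<alpha>)\<close>.
  
  For the BDF of order \<open>k \<le> 6\<close>, the symbol factors as \<open>(1 - \<zeta>) * P \<zeta>\<close> where \<open>P\<close> is a polynomial without zeros in the
  closed unit disc. This is the root condition, that is, the zero-stability of the method. Thus
  \<open>P powr -\<alpha>\<close> is holomorphic on a larger disc and its Taylor coefficients decay geometrically, whereas
  those of \<open>(1 - \<zeta>) powr -\<alpha>\<close> are \<open>pochhammer \<alpha> n / fact n \<le> (n + 1) powr (\<alpha> - 1)\<close>. The convolution of the two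
  sequences inherits the slower decay.\<close>

section \<open>Two inequalities for sums\<close>

lemma Holder_inequality_sum:
  fixes f g :: "'i \<Rightarrow> real"
  assumes "1 < p" "1 < q" "1 / p + 1 / q = 1"
    and "\<And>i. i \<in> I \<Longrightarrow> 0 \<le> f i" "\<And>i. i \<in> I \<Longrightarrow> 0 \<le> g i"
  shows "(\<Sum>i\<in>I. f i * g i) \<le> (\<Sum>i\<in>I. f i powr p) powr (1 / p) * (\<Sum>i\<in>I. g i powr q) powr (1 / q)"
proof (cases "finite I \<and> (\<Sum>i\<in>I. f i powr p) \<noteq> 0 \<and> (\<Sum>i\<in>I. g i powr q) \<noteq> 0")
  case True
  define F where "F = (\<Sum>i\<in>I. f i powr p)"
  define G where "G = (\<Sum>i\<in>I. g i powr q)"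
  define a where "a = F powr (1 / p)"
  define b where "b = G powr (1 / q)"
  have "0 \<le> F" "0 \<le> G" unfolding F_def G_def by (auto intro: sum_nonneg)
  with True have pos: "F > 0" "G > 0" by (auto simp: F_def G_def)
  have ab: "a > 0" "b > 0" "a powr p = F" "b powr q = G"
    using pos assms(1,2) by (auto simp: a_def b_def powr_powr)
  have "(\<Sum>i\<in>I. f i / a * (g i / b)) \<le> (\<Sum>i\<in>I. (f i / a) powr p / p + (g i / b) powr q / q)"
    using assms ab by (intro sum_mono Youngs_inequality) auto
  also have "\<dots> = (\<Sum>i\<in>I. f i powr p / F / p + g i powr q / G / q)"
    using assms ab by (intro sum.cong refl) (simp add: powr_divide)
  also have "\<dots> = F / F / p + G / G / q"
    by (simp add: sum.distrib F_def G_def flip: sum_divide_distrib)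
  also have "\<dots> = 1" using pos assms(3) by simp
  finally have "(\<Sum>i\<in>I. f i / a * (g i / b)) \<le> 1" .
  moreover have "(\<Sum>i\<in>I. f i / a * (g i / b)) = (\<Sum>i\<in>I. f i * g i) / (a * b)"
    by (simp add: sum_divide_distrib)
  ultimately have "(\<Sum>i\<in>I. f i * g i) \<le> a * b"
    using ab by (simp add: divide_le_eq)
  then show ?thesis by (simp add: a_def b_def F_def G_def)
next
  case False
  then consider "infinite I" | "finite I" "(\<Sum>i\<in>I. f i powr p) = 0" | "finite I" "(\<Sum>i\<in>I. g i powr q) = 0"
    by blast
  then have "(\<Sum>i\<in>I. f i * g i) = 0"
  proof cases
    case 2
    then have "f i = 0" if "i \<in> I" for i using that by (simp add: sum_nonneg_eq_0_iff)
    then show ?thesis by simp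
  next
    case 3
    then have "g i = 0" if "i \<in> I" for i using that by (simp add: sum_nonneg_eq_0_iff)
    then show ?thesis by simp
  qed simp
  then show ?thesis by simp
qed

text \<open>By Young's inequality each term is at most the increment of \<open>x powr (1 - \<beta>) / (1 - \<beta>)\<close> over the unit
  interval ending at \<open>i\<close>.\<close>

lemma sum_powr_minus_le:
  fixes \<beta> :: real
  assumes "0 < \<beta>" "\<beta> < 1"
  shows "(\<Sum>i=1..n. real i powr (- \<beta>)) \<le> real n powr (1 - \<beta>) / (1 - \<beta>)"
proof (induction n)
  case (Suc n)
  have "(1 - \<beta>) * real (Suc n) powr (- \<beta>) \<le> real (Suc n) powr (1 - \<beta>) - real n powr (1 - \<beta>)"
  proof (cases "n = 0")
    case False
    have "real n powr (1 - \<beta>) * real (Suc n) powr \<beta> \<le> (1 - \<beta>) * real n + \<beta> * real (Suc n)"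
      by (rule Youngs_inequality_0) (use assms False in auto)
    then have "real n powr (1 - \<beta>) * real (Suc n) powr \<beta> * real (Suc n) powr (- \<beta>)
        \<le> (real (Suc n) - (1 - \<beta>)) * real (Suc n) powr (- \<beta>)"
      by (intro mult_right_mono) (auto simp: algebra_simps)
    moreover have "real (Suc n) powr \<beta> * real (Suc n) powr (- \<beta>) = 1"
      by (simp flip: powr_add)
    moreover have "real (Suc n) * real (Suc n) powr (- \<beta>) = real (Suc n) powr (1 - \<beta>)"
      by (simp add: powr_mult_base)
    ultimately show ?thesis by (simp add: algebra_simps mult.assoc)
  qed (use assms in auto)
  then have "real (Suc n) powr (- \<beta>) \<le> (real (Suc n) powr (1 - \<beta>) - real n powr (1 - \<beta>)) / (1 - \<beta>)"
    using assms by (simp add: field_simps)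
  with Suc.IH show ?case by (simp add: diff_divide_distrib)
qed simp

section \<open>The fractional integral and its mapping property\<close>

text \<open>Associativity of convolution. The sum may start at \<open>1\<close> because \<open>frac_diff\<close> vanishes at \<open>0\<close> together
  with \<open>v\<close>.\<close>

lemma convolution_inverse:
  fixes v :: "nat \<Rightarrow> 'x::real_normed_vector"
  assumes "Abs_fps b * Abs_fps K = (1 :: real fps)" "0 < \<tau>" "v 0 = 0"
  shows "v n = \<tau> powr \<alpha> *\<^sub>R (\<Sum>j=1..n. b (n - j) *\<^sub>R frac_diff K \<alpha> \<tau> v j)"
proof -
  have conv: "(\<Sum>i=0..m. b (m - i) * K i) = (if m = 0 then 1 else 0)" for m
  proof -
    have "(\<Sum>i=0..m. b (m - i) * K i) = (\<Sum>i=0..m. b i * K (m - i))"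
      by (rule sum.reindex_bij_witness[of _ "\<lambda>i. m - i" "\<lambda>i. m - i"]) auto
    also have "\<dots> = fps_nth (Abs_fps b * Abs_fps K) m"
      by (simp add: fps_mult_nth)
    finally show ?thesis using assms(1) by simp
  qed
  define f where "f j = (\<Sum>i=0..j. K (j - i) *\<^sub>R v i)" for j
  have "(\<Sum>j=0..n. b (n - j) *\<^sub>R f j) = (\<Sum>j=0..n. \<Sum>i=0..j. (b (n - j) * K (j - i)) *\<^sub>R v i)"
    by (simp add: f_def scaleR_sum_right)
  also have "\<dots> = (\<Sum>i=0..n. \<Sum>j=i..n. (b (n - j) * K (j - i)) *\<^sub>R v i)"
    unfolding sum.Sigma[OF finite_atLeastAtMost, simplified] 
    by (subst sum.Sigma; simp)+
       (rule sum.reindex_bij_witness[of _ "\<lambda>(i, j). (j, i)" "\<lambda>(i, j). (j, i)"]; auto)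
  also have "\<dots> = (\<Sum>i=0..n. (if i = n then 1 else 0) *\<^sub>R v i)"
  proof (intro sum.cong refl)
    fix i assume i: "i \<in> {0..n}"
    have "(\<Sum>j=i..n. b (n - j) * K (j - i)) = (\<Sum>l=0..n - i. b (n - i - l) * K l)"
      by (rule sum.reindex_bij_witness[of _ "\<lambda>l. l + i" "\<lambda>j. j - i"]) (use i in auto)
    also have "\<dots> = (if i = n then 1 else 0)" unfolding conv using i by auto
    finally show "(\<Sum>j=i..n. (b (n - j) * K (j - i)) *\<^sub>R v i) = (if i = n then 1 else 0) *\<^sub>R v i"
      by (simp flip: scaleR_sum_left)
  qed
  also have "\<dots> = v n" by (simp add: if_distrib[of "\<lambda>c. c *\<^sub>R _"] cong: if_cong)
  finally have eq: "(\<Sum>j=0..n. b (n - j) *\<^sub>R f j) = v n" .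
  have "f 0 = 0" using assms(3) by (simp add: f_def)
  then have "(\<Sum>j=0..n. b (n - j) *\<^sub>R f j) = (\<Sum>j=1..n. b (n - j) *\<^sub>R f j)"
    by (intro sum.mono_neutral_right) (auto simp: not_le)
  moreover have "f j = \<tau> powr \<alpha> *\<^sub>R frac_diff K \<alpha> \<tau> v j" for j
    using assms(2) by (simp add: frac_diff_def f_def)
  ultimately show ?thesis using eq by (simp add: scaleR_sum_right mult.commute)
qed

text \<open>Discrete analogue of the embedding of the fractional Sobolev space of order \<open>\<alpha>\<close> with exponent \<open>p\<close> into
  the bounded functions: Hoelder's inequality is applied to the discrete fractional integral. With \<open>q\<close> conjugate
  to \<open>p\<close>, the kernel \<open>n powr (\<alpha> - 1)\<close> has \<open>q\<close>-th power \<open>n powr -(1 - \<gamma>)\<close>, and \<open>\<gamma> > 0\<close> is exactly \<open>p > 1 / \<alpha>\<close>.\<close>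

lemma sup_le_frac_diff_lp:
  fixes v :: "nat \<Rightarrow> 'x::real_normed_vector"
  assumes "0 < \<alpha>" "\<alpha> < 1" "1 / \<alpha> < p" "0 < \<tau>" "0 \<le> C" "v 0 = 0"
    and inv: "Abs_fps b * Abs_fps K = (1 :: real fps)"
    and b: "\<And>n. \<bar>b n\<bar> \<le> C * real (Suc n) powr (\<alpha> - 1)"
  defines "\<gamma> \<equiv> (\<alpha> * p - 1) / (p - 1)"
  shows "norm (v n) \<le> C * \<gamma> powr (- (1 - 1 / p)) * (\<tau> * real n) powr (\<alpha> - 1 / p)
           * seq_lp_norm \<tau> p n (frac_diff K \<alpha> \<tau> v)"
proof -
  define q where "q = p / (p - 1)"
  define f where "f = frac_diff K \<alpha> \<tau> v"
  have "1 < 1 / \<alpha>" using assms(1,2) by simp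
  then have p: "1 < p" "1 < \<alpha> * p"
    using assms(1,3) by (linarith, simp add: divide_less_eq mult.commute)
  have q: "1 < q" "1 / p + 1 / q = 1" "1 / q = 1 - 1 / p" using p by (auto simp: q_def field_simps)
  have \<gamma>: "0 < \<gamma>" "\<gamma> < 1" using p assms(1,2) by (auto simp: \<gamma>_def)
  have \<gamma>q: "\<gamma> * (1 / q) = \<alpha> - 1 / p" "(\<alpha> - 1) * q = - (1 - \<gamma>)"
    using p by (auto simp: \<gamma>_def q_def field_simps)
  have "norm (v n) \<le> \<tau> powr \<alpha> * (\<Sum>j=1..n. \<bar>b (n - j)\<bar> * norm (f j))"
    unfolding f_def
    by (subst convolution_inverse[where v = v and n = n and \<alpha> = \<alpha>, OF inv assms(4,6)])
       (auto intro!: order.trans[OF norm_sum] sum_mono mult_left_mono)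
  also have "\<dots> \<le> \<tau> powr \<alpha> * (\<Sum>j=1..n. C * real (Suc (n - j)) powr (\<alpha> - 1) * norm (f j))"
    by (intro mult_left_mono sum_mono mult_right_mono b) auto
  also have "\<dots> = \<tau> powr \<alpha> * C * (\<Sum>j=1..n. norm (f j) * real (Suc (n - j)) powr (\<alpha> - 1))"
    by (simp add: sum_distrib_left mult_ac)
  also have "\<dots> \<le> \<tau> powr \<alpha> * C * ((\<Sum>j=1..n. norm (f j) powr p) powr (1 / p)
      * (\<Sum>j=1..n. (real (Suc (n - j)) powr (\<alpha> - 1)) powr q) powr (1 / q))"
    by (intro mult_left_mono Holder_inequality_sum) (use p q assms(5) in auto)
  also have "(\<Sum>j=1..n. (real (Suc (n - j)) powr (\<alpha> - 1)) powr q) = (\<Sum>i=1..n. real i powr (- (1 - \<gamma>)))"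
    unfolding powr_powr \<gamma>q
    by (rule sum.reindex_bij_witness[of _ "\<lambda>i. Suc n - i" "\<lambda>j. Suc n - j"]) (auto simp: Suc_diff_le)
  also have "\<tau> powr \<alpha> * C * ((\<Sum>j=1..n. norm (f j) powr p) powr (1 / p)
      * (\<Sum>i=1..n. real i powr (- (1 - \<gamma>))) powr (1 / q))
    \<le> \<tau> powr \<alpha> * C * ((\<Sum>j=1..n. norm (f j) powr p) powr (1 / p) * (real n powr \<gamma> / \<gamma>) powr (1 / q))"
    using sum_powr_minus_le[of "1 - \<gamma>" n] \<gamma> p q assms(5)
    by (intro mult_left_mono powr_mono2 sum_nonneg) auto
  also have "(real n powr \<gamma> / \<gamma>) powr (1 / q) = real n powr (\<alpha> - 1 / p) * \<gamma> powr (- (1 - 1 / p))"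
    unfolding \<gamma>q(1)[symmetric] q(3)[symmetric] using \<gamma>
    by (simp add: powr_divide powr_powr powr_minus_divide)
  also have "(\<Sum>j=1..n. norm (f j) powr p) powr (1 / p) = \<tau> powr (- (1 / p)) * seq_lp_norm \<tau> p n f"
    using assms(4) by (simp add: seq_lp_norm_def powr_mult sum_nonneg powr_minus flip: sum_distrib_left)
  also have "\<tau> powr \<alpha> * C * (\<tau> powr (- (1 / p)) * seq_lp_norm \<tau> p n f * (real n powr (\<alpha> - 1 / p) * \<gamma> powr (- (1 - 1 / p))))
     = C * \<gamma> powr (- (1 - 1 / p)) * ((\<tau> powr \<alpha> * \<tau> powr (- (1 / p))) * real n powr (\<alpha> - 1 / p)) * seq_lp_norm \<tau> p n f"
    by (simp add: mult_ac)
  also have "(\<tau> powr \<alpha> * \<tau> powr (- (1 / p))) * real n powr (\<alpha> - 1 / p) = (\<tau> * real n) powr (\<alpha> - 1 / p)"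
    using assms(4) by (simp add: powr_mult flip: powr_add)
  finally show ?thesis by (simp add: f_def)
qed

section \<open>Power series expansions at the origin\<close>

text \<open>The expansion is asserted only off the origin, hence the value there has to be corrected.\<close>

lemma expands_at_0_has_fps_expansion:
  assumes "expands_at_0 F K"
  shows "F(0 := of_real (K 0)) has_fps_expansion Abs_fps (\<lambda>n. of_real (K n))"
proof -
  obtain r where r: "r > 0" "\<And>\<zeta>. 0 < norm \<zeta> \<Longrightarrow> norm \<zeta> < r \<Longrightarrow> (\<lambda>j. of_real (K j) * \<zeta> ^ j) sums F \<zeta>"
    using assms unfolding expands_at_0_def by blast
  have "summable (\<lambda>j. of_real (K j) * complex_of_real (r / 2) ^ j)"
    using r(1) by (intro sums_summable[OF r(2)]) auto
  then have "conv_radius (\<lambda>n. complex_of_real (K n)) \<ge> norm (complex_of_real (r / 2))"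
    by (rule conv_radius_geI)
  with r(1) have "fps_conv_radius (Abs_fps (\<lambda>n. complex_of_real (K n))) > 0"
    by (auto simp: fps_conv_radius_def intro: less_le_trans[rotated])
  moreover have "eval_fps (Abs_fps (\<lambda>n. of_real (K n))) z = (F(0 := of_real (K 0))) z" if "z \<in> ball 0 r" for z
    using that r(2)[of z] by (cases "z = 0") (auto simp: eval_fps_at_0, auto simp: eval_fps_def sums_iff)
  then have "\<forall>\<^sub>F z in nhds 0. eval_fps (Abs_fps (\<lambda>n. of_real (K n))) z = (F(0 := of_real (K 0))) z"
    using r(1) by (intro eventually_nhds_in_open[of "ball 0 r", THEN eventually_mono]) auto
  ultimately show ?thesis by (simp add: has_fps_expansion_def)
qed

lemma fps_expansion_unique_punctured:
  fixes F G :: "complex fps"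
  assumes "f has_fps_expansion F" "g has_fps_expansion G" "\<forall>\<^sub>F z in at 0. f z = g z"
  shows "F = G"
proof -
  have "f \<midarrow>0\<rightarrow> f 0" "g \<midarrow>0\<rightarrow> g 0"
    using assms(1,2) has_fps_expansion_imp_continuous by (auto simp flip: isCont_def continuous_within)
  then have "f 0 = g 0"
    using assms(3) by (metis (mono_tags, lifting) LIM_unique tendsto_cong)
  with assms(3) have "\<forall>\<^sub>F z in nhds 0. f z = g z"
    by (auto simp: eventually_at_filter elim: eventually_mono)
  then have "f has_fps_expansion G"
    using assms(2) by (auto simp: has_fps_expansion_def elim: eventually_elim2)
  with assms(1) show ?thesis by (rule fps_expansion_unique_complex)
qed

section \<open>Inverse weights of the L1 scheme\<close>

text \<open>Log-convexity compares neighbouring ratios \<open>a (Suc n) / a n\<close>, and induction compares arbitrary ones.\<close>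

lemma log_convex_ratio_mono:
  fixes a :: "nat \<Rightarrow> real"
  assumes pos: "\<And>n. 0 < a n" and lc: "\<And>n. (a (Suc n))\<^sup>2 \<le> a n * a (Suc (Suc n))" and "m \<le> n"
  shows "a (Suc m) * a n \<le> a m * a (Suc n)"
  using \<open>m \<le> n\<close>
proof (induction n rule: dec_induct)
  case (step n)
  have "a n * (a (Suc m) * a (Suc n)) \<le> a m * (a (Suc n))\<^sup>2"
    using mult_right_mono[OF step.IH, of "a (Suc n)"] pos[of "Suc n"] by (simp add: power2_eq_square mult_ac)
  also have "\<dots> \<le> a m * (a n * a (Suc (Suc n)))"
    using pos[of m] by (intro mult_left_mono lc) auto
  finally have "a n * (a (Suc m) * a (Suc n)) \<le> a n * (a m * a (Suc (Suc n)))"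
    by (simp add: mult_ac)
  then show ?case using pos[of n] by simp
qed (simp add: mult.commute)

text \<open>Kaluza's theorem on reciprocals of log-convex series. Eliminating the term \<open>q 0\<close> between the two convolution
  identities of index \<open>m\<close> and \<open>m + 1\<close> expresses \<open>q (m + 1)\<close> through \<open>q 1\<close>, ..., \<open>q m\<close> with coefficients whose sign
  is given by the monotonicity of ratios.\<close>

lemma Kaluza:
  fixes a q :: "nat \<Rightarrow> real"
  assumes pos: "\<And>n. 0 < a n" and lc: "\<And>n. (a (Suc n))\<^sup>2 \<le> a n * a (Suc (Suc n))"
    and inv: "Abs_fps a * Abs_fps q = 1"
  shows "0 < n \<Longrightarrow> q n \<le> 0"
proof (induction n rule: less_induct)
  case (less n)
  have conv: "(\<Sum>i\<le>m. q i * a (m - i)) = (if m = 0 then 1 else 0)" for m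
    using arg_cong[OF inv, of "\<lambda>F. fps_nth F m"] by (simp add: mult.commute[of "Abs_fps a"] fps_mult_nth atLeast0AtMost)
  have q0: "0 < q 0" using conv[of 0] pos[of 0] by (simp add: zero_less_mult_iff) (smt (verit) mult_nonpos_nonneg)
  obtain m where n: "n = Suc m" using less.prems by (cases n) auto
  show ?case
  proof (cases "m = 0")
    case True
    have "q 0 * a 1 + q 1 * a 0 = 0" using conv[of 1] by simp
    moreover have "0 < q 0 * a 1" using q0 pos[of 1] by simp
    ultimately have "q 1 * a 0 < 0" by linarith
    then show ?thesis using True pos[of 0] n by (simp add: mult_less_0_iff)
  next
    case False
    have 1: "(\<Sum>i\<le>m. q i * a (m - i)) = 0" "(\<Sum>i\<le>m. q i * a (Suc m - i)) + q (Suc m) * a 0 = 0"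
      using conv[of m] conv[of "Suc m"] False by auto
    have "0 = a m * (\<Sum>i\<le>m. q i * a (Suc m - i)) + a m * (q (Suc m) * a 0) - a (Suc m) * (\<Sum>i\<le>m. q i * a (m - i))"
      using 1 by (simp flip: distrib_left)
    also have "\<dots> = (\<Sum>i\<le>m. q i * (a (Suc m - i) * a m - a (m - i) * a (Suc m))) + a m * a 0 * q (Suc m)"
      by (simp add: sum_distrib_left algebra_simps sum_subtractf)
    finally have "a m * a 0 * q (Suc m) = - (\<Sum>i\<le>m. q i * (a (Suc m - i) * a m - a (m - i) * a (Suc m)))"
      by linarith
    moreover have "0 \<le> (\<Sum>i\<le>m. q i * (a (Suc m - i) * a m - a (m - i) * a (Suc m)))"
    proof (intro sum_nonneg)
      fix i assume i: "i \<in> {..m}"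
      show "0 \<le> q i * (a (Suc m - i) * a m - a (m - i) * a (Suc m))"
      proof (cases "i = 0")
        case False
        have "a (Suc (m - i)) * a m \<le> a (m - i) * a (Suc m)"
          by (rule log_convex_ratio_mono[of a, OF pos lc]) simp
        with False i less.IH[of i] n show ?thesis
          by (intro mult_nonpos_nonpos) (auto simp: Suc_diff_le)
      qed (simp add: mult.commute)
    qed
    ultimately have "a m * a 0 * q (Suc m) \<le> 0" by linarith
    then show ?thesis using pos[of m] pos[of 0] n by (simp add: mult_le_0_iff)
  qed
qed

text \<open>Up to the factor \<open>s\<close>, \<open>a n\<close> is the integral of \<open>x powr (s - 1)\<close> over \<open>{n..n + 1}\<close>, and log-convexity passes
  from the integrand to the integral. To avoid the integral, log-convexity is linearised: by the inequality of
  arithmetic and geometric means, \<open>2 * (x + 1) powr (s - 1) \<le> t * x powr (s - 1) + (x + 2) powr (s - 1) / t\<close> for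
  every \<open>t > 0\<close>. A primitive of the difference of the two sides is then monotone, and comparing its values at
  \<open>n\<close> and \<open>n + 1\<close> gives \<open>2 * a (Suc n) \<le> t * a n + a (Suc (Suc n)) / t\<close>.\<close>

lemma powr_increments_log_convex:
  fixes s :: real
  assumes "0 < s" "s < 1"
  defines "a \<equiv> (\<lambda>n. real (Suc n) powr s - real n powr s)"
  shows "(a (Suc n))\<^sup>2 \<le> a n * a (Suc (Suc n))" 
proof -
  have pos: "0 < a n" for n using assms by (simp add: a_def powr_less_mono2)
  \<comment> \<open>With this \<open>t\<close> the first term on the right of the linearised inequality is \<open>a (Suc n)\<close>,
    so that \<open>a (Suc n) * t\<close> is bounded by \<open>a (Suc (Suc n))\<close>.\<close>
  define t where "t = a (Suc n) / a n"
  have t: "0 < t" using pos by (simp add: t_def)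
  define h where "h x = t * x powr s + (x + 2) powr s / t - 2 * (x + 1) powr s" for x
  have "h (real n) \<le> h (real n + 1)"
  proof (rule DERIV_nonneg_imp_increasing_open[where f = h])
    fix x :: real assume x: "real n < x" "x < real n + 1"
    define P Q R where "P = x powr (s - 1)" and "Q = (x + 1) powr (s - 1)" and "R = (x + 2) powr (s - 1)"
    have x0: "x > 0" using x(1) by (meson le_less_trans of_nat_0_le_iff)
    have "((x + 1) * (x + 1)) powr (s - 1) \<le> (x * (x + 2)) powr (s - 1)"
      using x0 assms(2) by (intro powr_mono2') (auto simp: algebra_simps add_pos_pos)
    then have "Q\<^sup>2 \<le> P * R"
      using x0 by (simp add: P_def Q_def R_def powr_mult power2_eq_square)
    moreover have "4 * (P * R) \<le> (t * P + R / t)\<^sup>2"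
    proof -
      have "(t * P + R / t)\<^sup>2 = 4 * (P * R) + (t * P - R / t)\<^sup>2"
        using t by (simp add: power2_eq_square field_simps)
      then show ?thesis by simp
    qed
    ultimately have "(2 * Q)\<^sup>2 \<le> (t * P + R / t)\<^sup>2" by (simp add: power_mult_distrib)
    then have "2 * Q \<le> t * P + R / t"
      by (rule power2_le_imp_le) (use t in \<open>auto simp: P_def R_def\<close>)
    then have "0 \<le> s * (t * P + R / t - 2 * Q)" using assms by simp
    moreover have "(h has_real_derivative s * (t * P + R / t - 2 * Q)) (at x)"
      unfolding h_def P_def Q_def R_def using x0 t
      by (auto intro!: derivative_eq_intros simp: field_simps)
    ultimately show "\<exists>y. (h has_real_derivative y) (at x) \<and> 0 \<le> y" by blast
  next
    show "continuous_on {real n..real n + 1} h"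
      unfolding h_def using assms(1) t
      by (intro continuous_on_add continuous_on_diff continuous_on_mult continuous_on_divide
            continuous_on_powr' continuous_on_const continuous_on_id) auto
  qed simp
  then have "2 * a (Suc n) \<le> t * a n + a (Suc (Suc n)) / t"
    using t by (simp add: h_def a_def algebra_simps diff_divide_distrib)
  then have "a (Suc n) * t \<le> a (Suc (Suc n))"
    using t pos[of n] by (simp add: t_def field_simps)
  then show ?thesis
    using pos[of n] by (simp add: t_def power2_eq_square field_simps)
qed

lemma powr_increments_decreasing:
  fixes s :: real
  assumes "0 < s" "s < 1"
  defines "a \<equiv> (\<lambda>n. real (Suc n) powr s - real n powr s)"
  shows "a (Suc n) \<le> a n"
proof -
  define h where "h x = x powr s - (x + 1) powr s" for x :: real
  have "h (real n) \<le> h (real n + 1)"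
  proof (rule DERIV_nonneg_imp_increasing_open[where f = h])
    fix x :: real assume x: "real n < x" "x < real n + 1"
    have x0: "x > 0" using x(1) by (meson le_less_trans of_nat_0_le_iff)
    have "(h has_real_derivative s * (x powr (s - 1) - (x + 1) powr (s - 1))) (at x)"
      unfolding h_def using x0 by (auto intro!: derivative_eq_intros simp: field_simps)
    moreover have "(x + 1) powr (s - 1) \<le> x powr (s - 1)"
      using x0 assms by (intro powr_mono2') auto
    ultimately show "\<exists>y. (h has_real_derivative y) (at x) \<and> 0 \<le> y" using assms by force
  next
    show "continuous_on {real n..real n + 1} h"
      unfolding h_def using assms(1)
      by (intro continuous_on_add continuous_on_diff continuous_on_powr' continuous_on_const
            continuous_on_id) auto
  qed simp
  then show ?thesis by (simp add: h_def a_def algebra_simps)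
qed

lemma fps_one_minus_X_mult_nth:
  "fps_nth ((1 - fps_X) * F) n = fps_nth F n - (if n = 0 then 0 else fps_nth F (n - 1))"
  for F :: "'a::comm_ring_1 fps"
  by (simp add: left_diff_distrib)

text \<open>The coefficients \<open>(n + 1) powr (1 - \<alpha>)\<close> of \<open>polylog (\<alpha> - 1) \<zeta> / \<zeta>\<close> become their increments after
  multiplication by one of the two factors \<open>1 - \<zeta>\<close>. The other one is kept, since the partial sums that it produces
  in the reciprocal series are what makes the inverse weights monotone.\<close>

lemma l1_weights_factor:
  assumes "0 < \<alpha>" "\<alpha> < 1" and "expands_at_0 (l1_gen \<alpha>) K"
  shows "Abs_fps K = fps_const (1 / Gamma (2 - \<alpha>)) * ((1 - fps_X) *
           Abs_fps (\<lambda>n. real (Suc n) powr (1 - \<alpha>) - real n powr (1 - \<alpha>)))"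
proof -
  define l where "l = Abs_fps (\<lambda>n. complex_of_real (real (Suc n) powr (1 - \<alpha>)))"
  have l: "summable (\<lambda>n. fps_nth l n * z ^ n)" if "norm z < 1" for z :: complex
  proof (rule summable_comparison_test')
    show "summable (\<lambda>n. of_nat (Suc n) * norm z ^ n)"
      by (rule sums_summable[OF geometric_deriv_sums]) (use that in auto)
    fix n :: nat
    have "real (Suc n) powr (1 - \<alpha>) \<le> real (Suc n) powr 1"
      using assms(1) by (intro powr_mono) auto
    then show "norm (fps_nth l n * z ^ n) \<le> of_nat (Suc n) * norm z ^ n"
      by (auto simp: l_def norm_mult norm_power intro!: mult_right_mono)
  qed
  have radius: "fps_conv_radius l \<ge> 1" 
    unfolding fps_conv_radius_def
  proof (rule conv_radius_geI_ex)
    fix r :: real assume "0 < r" "ereal r < 1"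
    then show "\<exists>z. norm z = r \<and> summable (\<lambda>n. fps_nth l n * z ^ n)"
      by (intro exI[of _ "of_real r"] conjI l) auto
  qed
  have "(\<lambda>z. (1 / of_real (Gamma (2 - \<alpha>))) * ((1 - z) * ((1 - z) * eval_fps l z))) has_fps_expansion
      fps_const (1 / of_real (Gamma (2 - \<alpha>))) * ((1 - fps_X) * ((1 - fps_X) * l))"
    by (intro fps_expansion_intros eval_fps_has_fps_expansion less_le_trans[OF _ radius]) auto
  moreover have "\<forall>\<^sub>F z in at 0. (1 / of_real (Gamma (2 - \<alpha>))) * ((1 - z) * ((1 - z) * eval_fps l z))
      = ((l1_gen \<alpha>)(0 := of_real (K 0))) z"
  proof -
    have "(1 / of_real (Gamma (2 - \<alpha>))) * ((1 - z) * ((1 - z) * eval_fps l z)) = l1_gen \<alpha> z"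
      if z: "z \<in> ball 0 1 - {0}" for z
    proof -
      have "polylog (\<alpha> - 1) z = (\<Sum>n. z * (fps_nth l n * z ^ n))"
        unfolding polylog_def l_def
        by (simp add: powr_minus powr_diff field_simps)
      also have "\<dots> = z * eval_fps l z"
        using l[of z] z by (simp add: eval_fps_def suminf_mult)
      finally show ?thesis using z by (simp add: l1_gen_def power2_eq_square)
    qed
    then show ?thesis
      by (intro eventually_at_in_open[of "ball 0 1", THEN eventually_mono]) auto
  qed
  ultimately have "fps_const (1 / of_real (Gamma (2 - \<alpha>))) * ((1 - fps_X) * ((1 - fps_X) * l))
      = Abs_fps (\<lambda>n. of_real (K n))"
    by (intro fps_expansion_unique_punctured[OF _ expands_at_0_has_fps_expansion[OF assms(3)]])
  moreover have "(1 - fps_X) * l = Abs_fps (\<lambda>n. of_real (real (Suc n) powr (1 - \<alpha>) - real n powr (1 - \<alpha>)))"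
    by (rule fps_ext, case_tac n) (simp_all add: fps_one_minus_X_mult_nth l_def)
  ultimately have eq: "fps_const (1 / of_real (Gamma (2 - \<alpha>))) * ((1 - fps_X) *
        Abs_fps (\<lambda>n. of_real (real (Suc n) powr (1 - \<alpha>) - real n powr (1 - \<alpha>))))
      = Abs_fps (\<lambda>n. complex_of_real (K n))"
    by simp
  have "complex_of_real (K n) = of_real (fps_nth (fps_const (1 / Gamma (2 - \<alpha>)) * ((1 - fps_X) *
           Abs_fps (\<lambda>n. real (Suc n) powr (1 - \<alpha>) - real n powr (1 - \<alpha>)))) n)" for n
    using arg_cong[OF eq, of "\<lambda>F. fps_nth F n"]
    by (cases n) (simp_all add: fps_one_minus_X_mult_nth)
  then show ?thesis by (subst fps_eq_iff) (simp only: of_real_eq_iff fps_nth_Abs_fps, blast)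
qed

text \<open>The inverse weights are the partial sums of the reciprocal series \<open>q\<close> of \<open>a\<close>, scaled by \<open>Gamma (2 - \<alpha>)\<close>;
  Kaluza's theorem makes them decrease.\<close>

lemma l1_inverse_weights_bound:
  assumes "0 < \<alpha>" "\<alpha> < 1" and "expands_at_0 (l1_gen \<alpha>) K"
  obtains b where "Abs_fps b * Abs_fps K = 1"
    and "\<And>n. \<bar>b n\<bar> \<le> Gamma (2 - \<alpha>) * real (Suc n) powr (\<alpha> - 1)"
proof -
  define a where "a n = real (Suc n) powr (1 - \<alpha>) - real n powr (1 - \<alpha>)" for n
  define \<Gamma> where "\<Gamma> = Gamma (2 - \<alpha>)"
  define q where "q = fps_nth (inverse (Abs_fps a))"
  define b where "b n = \<Gamma> * (\<Sum>i\<le>n. q i)" for n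
  have \<Gamma>: "0 < \<Gamma>" using assms by (simp add: \<Gamma>_def Gamma_real_pos)
  have pos: "0 < a n" for n using assms by (simp add: a_def powr_less_mono2)
  have lc: "(a (Suc n))\<^sup>2 \<le> a n * a (Suc (Suc n))" for n
    unfolding a_def by (rule powr_increments_log_convex) (use assms in auto)
  have dec: "a (Suc n) \<le> a n" for n
    unfolding a_def by (rule powr_increments_decreasing) (use assms in auto)
  have q: "Abs_fps a * Abs_fps q = 1"
    using pos[of 0] by (simp add: q_def fps_nth_inverse inverse_mult_eq_1')
  have K: "Abs_fps K = fps_const (1 / \<Gamma>) * ((1 - fps_X) * Abs_fps a)"
    using l1_weights_factor[OF assms] by (simp add: a_def[abs_def] \<Gamma>_def)
  have bq: "(1 - fps_X) * Abs_fps b = fps_const \<Gamma> * Abs_fps q"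
  proof (rule fps_ext)
    fix n
    show "fps_nth ((1 - fps_X) * Abs_fps b) n = fps_nth (fps_const \<Gamma> * Abs_fps q) n"
      by (cases n) (simp_all add: fps_one_minus_X_mult_nth b_def distrib_left)
  qed
  have \<Gamma>1: "fps_const \<Gamma> * fps_const (1 / \<Gamma>) = 1" using \<Gamma> by simp
  have "Abs_fps b * Abs_fps K = fps_const (1 / \<Gamma>) * ((1 - fps_X) * Abs_fps b) * Abs_fps a"
    by (simp add: K mult_ac)
  also have "\<dots> = fps_const (1 / \<Gamma>) * (fps_const \<Gamma> * Abs_fps q) * Abs_fps a"
    by (simp only: bq)
  also have "\<dots> = (fps_const \<Gamma> * fps_const (1 / \<Gamma>)) * (Abs_fps a * Abs_fps q)"
    by (simp only: mult_ac)
  finally have inv: "Abs_fps b * Abs_fps K = 1" by (simp only: \<Gamma>1 q mult_1)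
  have ab: "(\<Sum>i\<le>n. b i * a (n - i)) = \<Gamma>" for n
  proof -
    have "(1 - fps_X) * (Abs_fps b * Abs_fps a) = fps_const \<Gamma> * (Abs_fps a * Abs_fps q)"
      unfolding mult.assoc[symmetric] bq by (simp only: mult_ac)
    then have *: "(1 - fps_X) * (Abs_fps b * Abs_fps a) = fps_const \<Gamma>" by (simp add: q)
    have "fps_nth (Abs_fps b * Abs_fps a) n = \<Gamma>"
    proof (induction n)
      case 0
      show ?case using arg_cong[OF *, of "\<lambda>F. fps_nth F 0"] by (simp add: fps_one_minus_X_mult_nth)
    next
      case (Suc n)
      then show ?case
        using arg_cong[OF *, of "\<lambda>F. fps_nth F (Suc n)"] by (simp add: fps_one_minus_X_mult_nth)
    qed
    then show ?thesis by (simp add: fps_mult_nth atLeast0AtMost)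
  qed
  \<comment> \<open>Subtracting the identities \<open>ab\<close> for consecutive indices writes \<open>b n * a 0\<close> as a combination of
    earlier \<open>b i\<close> with coefficients \<open>a (m - i) - a (m + 1 - i)\<close>, which are nonnegative.\<close>
  have b_nonneg: "0 \<le> b n" for n
  proof (induction n rule: less_induct)
    case (less n)
    show ?case
    proof (cases n)
      case 0
      then show ?thesis using ab[of 0] \<Gamma> pos[of 0] by (simp add: zero_le_mult_iff) (smt (verit) mult_nonpos_nonneg mult_neg_pos)
    next
      case (Suc m)
      have "b n * a 0 = (\<Sum>i\<le>m. b i * a (m - i)) - (\<Sum>i\<le>m. b i * a (Suc m - i))"
        using ab[of m] ab[of "Suc m"] Suc by simp
      also have "\<dots> = (\<Sum>i\<le>m. b i * (a (m - i) - a (Suc (m - i))))"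
        by (simp add: right_diff_distrib sum_subtractf Suc_diff_le)
      also have "\<dots> \<ge> 0"
        using less.IH Suc dec by (intro sum_nonneg mult_nonneg_nonneg) auto
      finally show ?thesis using pos[of 0] by (simp add: zero_le_mult_iff)
    qed
  qed
  have "decseq b"
    using Kaluza[OF pos lc q] \<Gamma> by (intro decseq_SucI) (simp add: b_def)
  have "\<bar>b n\<bar> \<le> \<Gamma> * real (Suc n) powr (\<alpha> - 1)" for n
  proof -
    have tele: "(\<Sum>i\<le>n. a i) = real (Suc n) powr (1 - \<alpha>)" for n
      by (induction n) (auto simp: a_def)
    have "b n * real (Suc n) powr (1 - \<alpha>) = (\<Sum>i\<le>n. b n * a (n - i))"
      unfolding tele[symmetric] sum_distrib_left
      by (rule sum.reindex_bij_witness[of _ "\<lambda>i. n - i" "\<lambda>i. n - i"]) auto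
    also have "\<dots> \<le> (\<Sum>i\<le>n. b i * a (n - i))"
      using \<open>decseq b\<close> pos by (intro sum_mono mult_right_mono) (auto simp: decseq_def less_imp_le)
    also have "\<dots> = \<Gamma>" by (rule ab)
    finally have "b n \<le> \<Gamma> / real (Suc n) powr (1 - \<alpha>)" by (simp add: pos_le_divide_eq)
    also have "\<dots> = \<Gamma> * real (Suc n) powr (\<alpha> - 1)"
      by (simp add: divide_inverse flip: powr_minus)
    finally show ?thesis using b_nonneg by simp
  qed
  with inv show ?thesis using that by (simp add: \<Gamma>_def)
qed

section \<open>Inverse weights of the backward difference formulas\<close>

lemma poly_nonzero_if_dominant_constant:
  fixes z :: complex
  assumes "norm z \<le> 1" "sum_list (map norm cs) < norm c"
  shows "poly (Poly (c # cs)) z \<noteq> 0"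
proof
  assume *: "poly (Poly (c # cs)) z = 0"
  have bound: "norm (poly (Poly ds) z) \<le> sum_list (map norm ds)" for ds :: "complex list"
  proof (induction ds)
    case (Cons d ds)
    have "norm (poly (Poly (d # ds)) z) \<le> norm d + norm z * norm (poly (Poly ds) z)"
      using norm_triangle_ineq[of d "z * poly (Poly ds) z"] by (simp add: norm_mult)
    also have "\<dots> \<le> norm d + 1 * sum_list (map norm ds)"
      using assms(1) Cons.IH by (intro add_left_mono mult_mono) auto
    finally show ?case by simp
  qed simp
  from * have "c = - (z * poly (Poly cs) z)" by (simp add: add_eq_0_iff2)
  then have "norm c = norm z * norm (poly (Poly cs) z)" by (simp add: norm_mult)
  also have "\<dots> \<le> 1 * sum_list (map norm cs)"
    using assms(1) bound by (intro mult_mono) auto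
  finally show False using assms(2) by simp
qed

text \<open>What remains of the BDF symbol after its zero at \<open>\<zeta> = 1\<close> is divided out.\<close>

definition bdf_cofactor :: "nat \<Rightarrow> complex \<Rightarrow> complex" where
  "bdf_cofactor k z = (\<Sum>j=1..k. 1 / of_nat j * (1 - z) ^ (j - 1))"

text \<open>The root condition for the BDF up to order six. For \<open>k \<le> 3\<close> the constant coefficient of the polynomial dominates
  the sum of the moduli of the others. For \<open>k > 3\<close> it does so after multiplication by an auxiliary polynomial, which is
  a multiple of a Taylor polynomial of the reciprocal at \<open>0\<close>, with coefficients rounded to integers. Such a multiplier
  exists because all zeros lie outside the closed disc.\<close>

lemma bdf_cofactor_nonzero:
  assumes "k \<in> {1..6}" "norm z \<le> 1"
  shows "bdf_cofactor k z \<noteq> 0"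
proof -
  have sums: "bdf_cofactor 1 z = 1"
    "2 * bdf_cofactor 2 z = 2 + (1 - z)"
    "6 * bdf_cofactor 3 z = 6 + 3 * (1 - z) + 2 * (1 - z) ^ 2"
    "12 * bdf_cofactor 4 z = 12 + 6 * (1 - z) + 4 * (1 - z) ^ 2 + 3 * (1 - z) ^ 3"
    "60 * bdf_cofactor 5 z = 60 + 30 * (1 - z) + 20 * (1 - z) ^ 2 + 15 * (1 - z) ^ 3 + 12 * (1 - z) ^ 4"
    "60 * bdf_cofactor 6 z = 60 + 30 * (1 - z) + 20 * (1 - z) ^ 2 + 15 * (1 - z) ^ 3 + 12 * (1 - z) ^ 4
       + 10 * (1 - z) ^ 5"
    by (simp_all add: bdf_cofactor_def numeral_eq_Suc distrib_left)
  have "2 * bdf_cofactor 2 z = poly (Poly [3, -1]) z"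
    unfolding sums by simp
  moreover have "6 * bdf_cofactor 3 z = poly (Poly [11, -7, 2]) z"
    unfolding sums by (simp, algebra)
  moreover have "12 * bdf_cofactor 4 z * (7 + 6 * z) = poly (Poly [175, -11, -47, 57, -18]) z"
    unfolding sums by (simp, algebra)
  moreover have "60 * bdf_cofactor 5 z * (2 + 2 * z + z ^ 2) = poly (Poly [274, -52, 85, -15, 35, -39, 12]) z"
    unfolding sums by (simp, algebra)
  moreover have "60 * bdf_cofactor 6 z * (5 + 7 * z + 2 * z ^ 2 - 3 * z ^ 3 - 2 * z ^ 4)
      = poly (Poly [735, -36, -12, -23, -12, -227, 69, 120, -94, 20]) z"
    unfolding sums by (simp, algebra)
  moreover have "poly (Poly [3, -1]) z \<noteq> 0" "poly (Poly [11, -7, 2]) z \<noteq> 0"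
    "poly (Poly [175, -11, -47, 57, -18]) z \<noteq> 0" "poly (Poly [274, -52, 85, -15, 35, -39, 12]) z \<noteq> 0"
    "poly (Poly [735, -36, -12, -23, -12, -227, 69, 120, -94, 20]) z \<noteq> 0"
    by (rule poly_nonzero_if_dominant_constant[OF assms(2)]; simp)+
  moreover have "k = 1 \<or> k = 2 \<or> k = 3 \<or> k = 4 \<or> k = 5 \<or> k = 6" using assms(1) by auto
  ultimately show ?thesis using sums(1) by (metis mult_zero_left mult_zero_right zero_neq_one)
qed

lemma bdf_gen_eq_cofactor: "bdf_gen k \<alpha> z = ((1 - z) * bdf_cofactor k z) powr of_real \<alpha>"
proof -
  have "(\<Sum>j=1..k. (1 / of_nat j) * (1 - z) ^ j) = (1 - z) * bdf_cofactor k z"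
    unfolding bdf_cofactor_def sum_distrib_left
    by (intro sum.cong refl) (auto simp flip: power_Suc)
  then show ?thesis by (simp add: bdf_gen_def)
qed

text \<open>By compactness the zeros keep a positive distance from the closed unit disc, so that there is a logarithm on a
  larger disc. It is determined up to a multiple of \<open>2 * pi * \<i>\<close>, which is fixed by making it real at \<open>0\<close>, in accordance
  with the branch of the power that defines the weights.\<close>

lemma bdf_cofactor_log:
  assumes "k \<in> {1..6}"
  obtains r h where "1 < r" "h holomorphic_on ball 0 r" "\<And>z. z \<in> ball 0 r \<Longrightarrow> exp (h z) = bdf_cofactor k z"
    and "Im (h 0) = 0"
proof -
  have hol: "bdf_cofactor k holomorphic_on A" for A
    unfolding bdf_cofactor_def by (intro holomorphic_intros)
  obtain r where r: "1 < r" "\<And>z. z \<in> ball 0 r \<Longrightarrow> bdf_cofactor k z \<noteq> 0"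
  proof -
    have "closed (bdf_cofactor k -` {0})"
      using hol[of UNIV] by (intro continuous_closed_vimage) (auto dest: holomorphic_on_imp_continuous_on simp: continuous_on_eq_continuous_at)
    moreover have "cball 0 1 \<inter> bdf_cofactor k -` {0} = {}"
      using bdf_cofactor_nonzero[OF assms] by auto
    ultimately obtain d where d: "d > 0" "\<forall>x\<in>cball 0 1. \<forall>y\<in>bdf_cofactor k -` {0}. d \<le> dist x y"
      using separate_compact_closed[of "cball 0 1" "bdf_cofactor k -` {0}"] by auto
    have "bdf_cofactor k z \<noteq> 0" if z: "z \<in> ball 0 (1 + d)" for z
    proof (cases "norm z \<le> 1")
      case False
      \<comment> \<open>The radial projection of \<open>z\<close> to the unit disc, at distance \<open>norm z - 1\<close>.\<close>
      define x where "x = z / of_real (norm z)"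
      have "z - x = of_real (norm z - 1) * x" using False
        by (cases "z = 0") (simp_all add: x_def left_diff_distrib diff_divide_distrib)
      moreover have "norm x = 1" using False by (auto simp: x_def norm_divide)
      ultimately have "norm (z - x) = \<bar>norm z - 1\<bar>" "x \<in> cball 0 1"
        by (auto simp only: norm_mult norm_of_real mult_1_right mem_cball_0)
      then have "dist x z < d" "x \<in> cball 0 1"
        using z False by (auto simp: dist_norm norm_minus_commute)
      with d(2) show ?thesis by force
    qed (use bdf_cofactor_nonzero[OF assms] in auto)
    with d(1) show ?thesis by (intro that[of "1 + d"]) auto
  qed
  obtain g where g: "g holomorphic_on ball 0 r" "\<And>z. z \<in> ball 0 r \<Longrightarrow> exp (g z) = bdf_cofactor k z"
    using holomorphic_logarithm_exists[OF _ _ hol r(2), of "ball 0 r" 0] r(1) by auto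
  have at_0: "bdf_cofactor k 0 = of_real (\<Sum>j=1..k. 1 / real j)"
    by (simp add: bdf_cofactor_def)
  have "0 < (\<Sum>j=1..k. 1 / real j)"
    using assms by (intro sum_pos) auto
  then have exp0: "exp (of_real (ln (\<Sum>j=1..k. 1 / real j))) = bdf_cofactor k 0"
    unfolding at_0 exp_of_real by simp
  show ?thesis
  proof (rule that[of r "\<lambda>z. g z - g 0 + of_real (ln (\<Sum>j=1..k. 1 / real j))"])
    fix z :: complex assume "z \<in> ball 0 r"
    then show "exp (g z - g 0 + of_real (ln (\<Sum>j=1..k. 1 / real j))) = bdf_cofactor k z"
      using g(2)[of z] g(2)[of 0] exp0 r(1) r(2)[of 0]
      by (simp add: exp_add exp_diff)
  qed (use r(1) g(1) in \<open>auto intro!: holomorphic_intros\<close>)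
qed

text \<open>The quotient of consecutive coefficients is \<open>1 - (1 - \<alpha>) * x\<close> with \<open>x = 1 / (n + 1)\<close>, and
  \<open>1 - (1 - \<alpha>) * x \<le> (1 + x) powr (\<alpha> - 1)\<close>, which is the quotient of the two consecutive bounds.\<close>

lemma binomial_coeff_bound:
  fixes \<alpha> :: real
  assumes "0 < \<alpha>" "\<alpha> < 1"
  shows "pochhammer \<alpha> n / fact n \<le> real (Suc n) powr (\<alpha> - 1)"
proof (induction n)
  case (Suc n)
  define x where "x = 1 / real (Suc n)"
  have x: "0 < x" by (simp add: x_def)
  have "(\<alpha> + real n) / real (Suc n) = 1 + (\<alpha> - 1) * x"
    by (simp add: x_def field_simps)
  also have "\<dots> \<le> exp ((\<alpha> - 1) * x)" by (rule exp_ge_add_one_self)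
  also have "\<dots> \<le> exp ((\<alpha> - 1) * ln (1 + x))"
    using assms ln_add_one_self_le_self[of x] unfolding exp_le_cancel_iff
    by (intro mult_left_mono_neg) (auto simp: x_def)
  also have "\<dots> = (1 + x) powr (\<alpha> - 1)" using x by (simp add: powr_def)
  finally have *: "(\<alpha> + real n) / real (Suc n) \<le> (1 + x) powr (\<alpha> - 1)" .
  have "pochhammer \<alpha> (Suc n) / fact (Suc n) = (\<alpha> + real n) / real (Suc n) * (pochhammer \<alpha> n / fact n)"
    by (simp add: pochhammer_Suc)
  also have "\<dots> \<le> (1 + x) powr (\<alpha> - 1) * real (Suc n) powr (\<alpha> - 1)"
    using assms by (intro mult_mono * Suc.IH) (auto intro!: divide_nonneg_pos pochhammer_nonneg)
  also have "\<dots> = ((1 + x) * real (Suc n)) powr (\<alpha> - 1)"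
    by (simp add: powr_mult x_def)
  also have "(1 + x) * real (Suc n) = real (Suc (Suc n))"
    by (simp add: x_def field_simps)
  finally show ?case .
qed simp

text \<open>From \<open>n + 1 \<le> (i + 1) * (n - i + 1)\<close> it follows that shifting the algebraic decay by \<open>i\<close> costs at most a factor
  \<open>i + 1\<close>, and this factor is absorbed by the decay of \<open>d\<close>.\<close>

lemma convolution_decay_bound:
  fixes d e :: "nat \<Rightarrow> complex"
  assumes "0 < \<alpha>" "\<alpha> < 1" and e: "\<And>n. norm (e n) \<le> real (Suc n) powr (\<alpha> - 1)"
    and d: "summable (\<lambda>n. norm (d n) * real (Suc n))"
  shows "norm (\<Sum>i=0..n. d i * e (n - i)) \<le> (\<Sum>i. norm (d i) * real (Suc i)) * real (Suc n) powr (\<alpha> - 1)"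
proof -
  have term_le: "norm (d i * e (n - i)) \<le> norm (d i) * real (Suc i) * real (Suc n) powr (\<alpha> - 1)" if "i \<le> n" for i
  proof -
    have "Suc (i + m) \<le> Suc i * Suc m" for m
      by (simp add: algebra_simps)
    from this[of "n - i"] have "Suc n \<le> Suc i * Suc (n - i)"
      using that by simp
    then have "real (Suc n) \<le> real (Suc i) * real (Suc (n - i))"
      by (metis of_nat_le_iff of_nat_mult)
    then have "(real (Suc i) * real (Suc (n - i))) powr (\<alpha> - 1) \<le> real (Suc n) powr (\<alpha> - 1)"
      using assms by (intro powr_mono2') auto
    then have "real (Suc i) powr (1 - \<alpha>) * (real (Suc i) powr (\<alpha> - 1) * real (Suc (n - i)) powr (\<alpha> - 1))
        \<le> real (Suc i) powr (1 - \<alpha>) * real (Suc n) powr (\<alpha> - 1)"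
      by (intro mult_left_mono) (simp_all only: powr_mult of_nat_0_le_iff powr_ge_zero)
    moreover have "real (Suc i) powr (1 - \<alpha>) * real (Suc i) powr (\<alpha> - 1) = 1"
      by (simp flip: powr_add)
    ultimately have "real (Suc (n - i)) powr (\<alpha> - 1) \<le> real (Suc i) powr (1 - \<alpha>) * real (Suc n) powr (\<alpha> - 1)"
      by (simp only: mult.assoc[symmetric] mult_1)
    also have "\<dots> \<le> real (Suc i) powr 1 * real (Suc n) powr (\<alpha> - 1)"
      using assms by (intro mult_right_mono powr_mono) auto
    finally have "norm (e (n - i)) \<le> real (Suc i) * real (Suc n) powr (\<alpha> - 1)"
      using e[of "n - i"] by simp
    then show ?thesis
      by (simp add: norm_mult mult.assoc mult_left_mono)
  qed
  have "norm (\<Sum>i=0..n. d i * e (n - i)) \<le> (\<Sum>i=0..n. norm (d i) * real (Suc i) * real (Suc n) powr (\<alpha> - 1))"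
    by (intro order.trans[OF norm_sum] sum_mono term_le) auto
  also have "\<dots> = (\<Sum>i=0..n. norm (d i) * real (Suc i)) * real (Suc n) powr (\<alpha> - 1)"
    by (simp add: sum_distrib_right)
  also have "\<dots> \<le> (\<Sum>i. norm (d i) * real (Suc i)) * real (Suc n) powr (\<alpha> - 1)"
    by (intro mult_right_mono sum_le_suminf d) auto
  finally show ?thesis .
qed

lemma fps_coeffs_weighted_summable:
  fixes D :: "complex fps"
  assumes "1 < fps_conv_radius D"
  shows "summable (\<lambda>n. norm (fps_nth D n) * real (Suc n))"
proof -
  obtain \<rho> where \<rho>: "1 < \<rho>" "ereal \<rho> < fps_conv_radius D"
    using assms ereal_dense2[of 1] by (auto simp: one_ereal_def)
  have "summable (\<lambda>n. norm (fps_nth D n * of_real \<rho> ^ n))"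
    using \<rho> by (intro norm_summable_fps) auto
  then have *: "summable (\<lambda>n. norm (fps_nth D n) * \<rho> ^ n)"
    using \<rho>(1) by (simp add: norm_mult norm_power)
  define \<delta> where "\<delta> = min 1 (\<rho> - 1)"
  have \<delta>: "0 < \<delta>" "\<delta> \<le> 1" "\<delta> \<le> \<rho> - 1" using \<rho> by (auto simp: \<delta>_def)
  show ?thesis
  proof (rule summable_comparison_test')
    show "summable (\<lambda>n. norm (fps_nth D n) * \<rho> ^ n / \<delta>)"
      using * by (rule summable_divide)
    fix n :: nat
    have "\<delta> * real (Suc n) \<le> 1 + real n * \<delta>" using \<delta> by (simp add: algebra_simps)
    also have "\<dots> \<le> (1 + \<delta>) ^ n" using \<delta> by (intro Bernoulli_inequality) auto
    also have "\<dots> \<le> \<rho> ^ n" using \<delta> by (intro power_mono) auto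
    finally have "real (Suc n) \<le> \<rho> ^ n / \<delta>" using \<delta> by (simp add: field_simps)
    then show "norm (norm (fps_nth D n) * real (Suc n)) \<le> norm (fps_nth D n) * \<rho> ^ n / \<delta>"
      using mult_left_mono[of "real (Suc n)" "\<rho> ^ n / \<delta>" "norm (fps_nth D n)"] by (simp add: abs_mult)
  qed
qed

text \<open>Complex analysis yields the reciprocal series with complex coefficients; by uniqueness of reciprocals it is the
  real one.\<close>

lemma real_inverse_of_complex_inverse:
  assumes "Abs_fps (\<lambda>n. complex_of_real (K n)) * B = 1"
  obtains b where "Abs_fps b * Abs_fps K = 1" "\<And>n. \<bar>b n\<bar> = norm (fps_nth B n)"
proof -
  define k where "k = Abs_fps (\<lambda>n. complex_of_real (K n))"
  define b where "b = fps_nth (inverse (Abs_fps K))"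
  have "complex_of_real (K 0) * fps_nth B 0 = 1"
    using arg_cong[OF assms, of "\<lambda>F. fps_nth F 0"] by simp
  then have "K 0 \<noteq> 0" by auto
  then have inv: "Abs_fps b * Abs_fps K = 1" by (simp add: b_def fps_nth_inverse inverse_mult_eq_1)
  have "Abs_fps (\<lambda>n. complex_of_real (b n)) * k = 1"
  proof (rule fps_ext)
    fix n
    have "fps_nth (Abs_fps (\<lambda>n. complex_of_real (b n)) * k) n = of_real (fps_nth (Abs_fps b * Abs_fps K) n)"
      by (simp add: k_def fps_mult_nth)
    then show "fps_nth (Abs_fps (\<lambda>n. complex_of_real (b n)) * k) n = fps_nth 1 n" by (simp add: inv)
  qed
  then have "Abs_fps (\<lambda>n. complex_of_real (b n)) = B"
    using assms unfolding k_def[symmetric] by (metis mult.assoc mult.left_neutral mult.right_neutral)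
  then have "\<bar>b n\<bar> = norm (fps_nth B n)" for n by (metis fps_nth_Abs_fps norm_of_real real_norm_def)
  with inv show ?thesis by (rule that)
qed

text \<open>The bound on the imaginary part ensures that the principal logarithm of the product
  \<open>(1 - z) * bdf_cofactor k z\<close> is the sum of the logarithms chosen for the factors.\<close>

lemma bdf_gen_times_inverse:
  assumes "exp H = bdf_cofactor k z" "\<bar>Im (H + Ln (1 - z))\<bar> < pi" "z \<noteq> 1"
  shows "bdf_gen k \<alpha> z * (exp (- of_real \<alpha> * H) * (1 - z) powr (- of_real \<alpha>)) = 1"
proof -
  have "(1 - z) * bdf_cofactor k z = exp (H + Ln (1 - z))"
    using assms(1,3) by (simp add: exp_add)
  then have "bdf_gen k \<alpha> z = exp (of_real \<alpha> * (H + Ln (1 - z)))"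
    unfolding bdf_gen_eq_cofactor using assms(2) by (simp add: powr_def Ln_exp abs_less_iff)
  moreover have "exp (- of_real \<alpha> * H) * (1 - z) powr (- of_real \<alpha>) = exp (- (of_real \<alpha> * (H + Ln (1 - z))))"
    using assms(3) by (simp add: powr_def distrib_left flip: exp_add)
  ultimately show ?thesis by (simp flip: exp_add)
qed

text \<open>Newton's binomial series, with the signs absorbed into Pochhammer symbols.\<close>

lemma one_minus_powr_has_fps_expansion:
  fixes \<alpha> :: real
  shows "(\<lambda>z. (1 - z) powr (- of_real \<alpha>)) has_fps_expansion
           Abs_fps (\<lambda>n. complex_of_real (pochhammer \<alpha> n / fact n))"
proof -
  let ?E = "Abs_fps (\<lambda>n. complex_of_real (pochhammer \<alpha> n / fact n))"
  have coeff: "((- of_real \<alpha>) gchoose n) * (- z) ^ n = fps_nth ?E n * z ^ n" for n and z :: complex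
  proof -
    have "((- of_real \<alpha>) gchoose n) = (- 1) ^ n * complex_of_real (pochhammer \<alpha> n / fact n)"
      by (simp add: gbinomial_pochhammer pochhammer_of_real)
    moreover have "(- 1) ^ n * (- z) ^ n = z ^ n" by (simp flip: power_mult_distrib)
    ultimately show ?thesis by (metis fps_nth_Abs_fps mult.assoc mult.commute)
  qed
  have sums: "(\<lambda>n. fps_nth ?E n * z ^ n) sums ((1 - z) powr (- of_real \<alpha>))" if "norm z < 1" for z
    using gen_binomial_complex[of "- z" "- of_real \<alpha>"] that by (simp only: coeff norm_minus_cancel) simp
  have "conv_radius (fps_nth ?E) \<ge> norm (1 / 2 :: complex)"
    by (rule conv_radius_geI, rule sums_summable[OF sums]) auto
  then have "fps_conv_radius ?E > 0"
    by (auto simp: fps_conv_radius_def intro: less_le_trans[rotated])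
  moreover have "\<forall>\<^sub>F z in nhds 0. eval_fps ?E z = (1 - z) powr (- of_real \<alpha>)"
    using sums by (intro eventually_nhds_in_open[of "ball 0 1", THEN eventually_mono])
                  (auto simp: eval_fps_def sums_iff)
  ultimately show ?thesis by (simp add: has_fps_expansion_def)
qed

lemma bdf_inverse_weights_bound:
  assumes "0 < \<alpha>" "\<alpha> < 1" and k: "k \<in> {1..6}"
  shows "\<exists>C>0. \<forall>K. expands_at_0 (bdf_gen k \<alpha>) K \<longrightarrow>
    (\<exists>b. Abs_fps b * Abs_fps K = 1 \<and> (\<forall>n. \<bar>b n\<bar> \<le> C * real (Suc n) powr (\<alpha> - 1)))"
proof -
  obtain r h where r: "1 < r" and h: "h holomorphic_on ball 0 r"
    "\<And>z. z \<in> ball 0 r \<Longrightarrow> exp (h z) = bdf_cofactor k z" and h0: "Im (h 0) = 0"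
    using bdf_cofactor_log[OF k] by blast
  define d where "d = fps_expansion (\<lambda>z. exp (- of_real \<alpha> * h z)) 0"
  define e where "e = Abs_fps (\<lambda>n. complex_of_real (pochhammer \<alpha> n / fact n))"
  have hol: "(\<lambda>z. exp (- of_real \<alpha> * h z)) holomorphic_on eball 0 (ereal r)"
    using h(1) by (auto intro!: holomorphic_intros)
  have radius: "fps_conv_radius d \<ge> ereal r"
    unfolding d_def by (rule conv_radius_fps_expansion[OF hol])
  have "\<forall>\<^sub>F z in nhds 0. eval_fps d z = exp (- of_real \<alpha> * h z)"
    using r eval_fps_expansion'[OF hol] unfolding d_def
    by (intro eventually_nhds_in_open[of "ball 0 r", THEN eventually_mono]) auto
  moreover have "0 < fps_conv_radius d" "1 < fps_conv_radius d"
    using r radius by (auto intro: less_le_trans[rotated])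
  ultimately have d: "(\<lambda>z. exp (- of_real \<alpha> * h z)) has_fps_expansion d"
    and d_summable: "summable (\<lambda>n. norm (fps_nth d n) * real (Suc n))"
    unfolding has_fps_expansion_def by (blast, intro fps_coeffs_weighted_summable)
  \<comment> \<open>The imaginary part of the sum of the two logarithms is continuous and vanishes at \<open>0\<close>.\<close>
  have near_0: "\<forall>\<^sub>F z in at 0. bdf_gen k \<alpha> z * (exp (- of_real \<alpha> * h z) * (1 - z) powr (- of_real \<alpha>)) = 1"
  proof -
    have "isCont h 0"
      using h(1) r by (intro continuous_on_interior[OF holomorphic_on_imp_continuous_on]) auto
    then have "isCont (\<lambda>z. \<bar>Im (h z + Ln (1 - z))\<bar>) 0"
      by (intro continuous_intros) auto
    then have "((\<lambda>z. \<bar>Im (h z + Ln (1 - z))\<bar>) \<longlongrightarrow> 0) (at 0)"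
      by (simp add: isCont_def h0)
    then have "\<forall>\<^sub>F z in at 0. \<bar>Im (h z + Ln (1 - z))\<bar> < pi"
      by (rule order_tendstoD) simp
    moreover have "\<forall>\<^sub>F z in at 0. z \<in> ball 0 1 - {0 :: complex}"
      by (intro eventually_at_in_open) auto
    ultimately show ?thesis
    proof eventually_elim
      case (elim z)
      then show ?case using r by (intro bdf_gen_times_inverse h(2)) auto
    qed
  qed
  \<comment> \<open>Positivity of the constant is ensured by using \<open>S + 1\<close> in place of \<open>S\<close>.\<close>
  define S where "S = (\<Sum>i. norm (fps_nth d i) * real (Suc i))"
  have "\<exists>b. Abs_fps b * Abs_fps K = 1 \<and> (\<forall>n. \<bar>b n\<bar> \<le> (S + 1) * real (Suc n) powr (\<alpha> - 1))"
    if K: "expands_at_0 (bdf_gen k \<alpha>) K" for K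
  proof -
    have "Abs_fps (\<lambda>n. complex_of_real (K n)) * (d * e) = 1"
    proof (rule fps_expansion_unique_punctured[where g = "\<lambda>_. 1" and
          f = "\<lambda>z. ((bdf_gen k \<alpha>)(0 := of_real (K 0))) z
            * (exp (- of_real \<alpha> * h z) * (1 - z) powr (- of_real \<alpha>))"])
      show "(\<lambda>z. ((bdf_gen k \<alpha>)(0 := of_real (K 0))) z * (exp (- of_real \<alpha> * h z) * (1 - z) powr (- of_real \<alpha>)))
          has_fps_expansion Abs_fps (\<lambda>n. complex_of_real (K n)) * (d * e)"
        unfolding e_def
        by (intro has_fps_expansion_mult d one_minus_powr_has_fps_expansion expands_at_0_has_fps_expansion[OF K])
      show "\<forall>\<^sub>F z in at 0. ((bdf_gen k \<alpha>)(0 := of_real (K 0))) z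
          * (exp (- of_real \<alpha> * h z) * (1 - z) powr (- of_real \<alpha>)) = 1"
        using near_0 by (auto simp: eventually_at_filter elim: eventually_mono)
    qed simp
    then obtain b where b: "Abs_fps b * Abs_fps K = 1" "\<And>n. \<bar>b n\<bar> = norm (fps_nth (d * e) n)"
      using real_inverse_of_complex_inverse by blast
    have "norm (fps_nth e n) \<le> real (Suc n) powr (\<alpha> - 1)" for n
      using binomial_coeff_bound[OF assms(1,2), of n] pochhammer_nonneg[of \<alpha> n] assms(1)
      by (simp add: e_def norm_divide)
    then have "norm (fps_nth (d * e) n) \<le> S * real (Suc n) powr (\<alpha> - 1)" for n
      unfolding fps_mult_nth S_def by (rule convolution_decay_bound[OF assms(1,2) _ d_summable])
    then have "\<bar>b n\<bar> \<le> (S + 1) * real (Suc n) powr (\<alpha> - 1)" for n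
      unfolding b(2) by (rule order.trans) (simp add: mult_right_mono)
    with b(1) show ?thesis by blast
  qed
  moreover have "S + 1 > 0" unfolding S_def using suminf_nonneg[OF d_summable] by (simp add: add_nonneg_pos)
  ultimately show ?thesis by blast
qed

section \<open>Decay of the inverse weights for all schemes\<close>

lemma scheme_inverse_weights_bound:
  assumes "0 < \<alpha>" "\<alpha> < 1"
  obtains C where "0 < C" "\<And>K. scheme_weights \<alpha> K \<Longrightarrow>
    \<exists>b. Abs_fps b * Abs_fps K = 1 \<and> (\<forall>n. \<bar>b n\<bar> \<le> C * real (Suc n) powr (\<alpha> - 1))"
proof -
  have "\<exists>D. \<forall>k\<in>{1..6}. 0 < D k \<and> (\<forall>K. expands_at_0 (bdf_gen k \<alpha>) K \<longrightarrow>
      (\<exists>b. Abs_fps b * Abs_fps K = 1 \<and> (\<forall>n. \<bar>b n\<bar> \<le> D k * real (Suc n) powr (\<alpha> - 1))))"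
    by (rule bchoice) (use bdf_inverse_weights_bound[OF assms] in blast)
  then obtain D where D: "\<And>k. k \<in> {1..6} \<Longrightarrow> 0 < D k"
    "\<And>k K. k \<in> {1..6} \<Longrightarrow> expands_at_0 (bdf_gen k \<alpha>) K \<Longrightarrow>
      \<exists>b. Abs_fps b * Abs_fps K = 1 \<and> (\<forall>n. \<bar>b n\<bar> \<le> D k * real (Suc n) powr (\<alpha> - 1))"
    by blast
  define C where "C = Gamma (2 - \<alpha>) + sum D {1..6}"
  have \<Gamma>: "0 < Gamma (2 - \<alpha>)" using assms by (simp add: Gamma_real_pos)
  have sum: "0 \<le> sum D {1..6}" using D(1) by (intro sum_nonneg less_imp_le) 
  have D_le: "D k \<le> C" if "k \<in> {1..6}" for k
  proof -
    have "D k \<le> sum D {1..6}" using that D(1) by (intro member_le_sum) (auto simp: less_imp_le)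
    then show ?thesis using \<Gamma> by (simp add: C_def)
  qed
  have weaken: "\<exists>b. Abs_fps b * Abs_fps K = 1 \<and> (\<forall>n. \<bar>b n\<bar> \<le> C * real (Suc n) powr (\<alpha> - 1))"
    if b: "Abs_fps b * Abs_fps K = 1" "\<And>n. \<bar>b n\<bar> \<le> B * real (Suc n) powr (\<alpha> - 1)" and "B \<le> C"
    for b B and K :: "nat \<Rightarrow> real"
  proof -
    have "\<bar>b n\<bar> \<le> C * real (Suc n) powr (\<alpha> - 1)" for n
      using \<open>B \<le> C\<close> by (intro order.trans[OF b(2)] mult_right_mono) auto
    with b(1) show ?thesis by blast
  qed
  show ?thesis
  proof (rule that)
    show "0 < C" using \<Gamma> sum by (simp add: C_def)
    fix K assume "scheme_weights \<alpha> K"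
    then consider "expands_at_0 (l1_gen \<alpha>) K" | k where "k \<in> {1..6}" "expands_at_0 (bdf_gen k \<alpha>) K"
      unfolding scheme_weights_def by blast
    then show "\<exists>b. Abs_fps b * Abs_fps K = 1 \<and> (\<forall>n. \<bar>b n\<bar> \<le> C * real (Suc n) powr (\<alpha> - 1))"
    proof cases
      case 1
      obtain b where b: "Abs_fps b * Abs_fps K = 1"
          "\<And>n. \<bar>b n\<bar> \<le> Gamma (2 - \<alpha>) * real (Suc n) powr (\<alpha> - 1)"
        using l1_inverse_weights_bound[OF assms 1] by blast
      show ?thesis by (rule weaken[OF b]) (use sum in \<open>simp add: C_def\<close>)
    next
      case (2 k)
      then show ?thesis using D(2)[OF 2] weaken D_le by blast
    qed
  qed
qed

section \<open>Gronwall inequalities\<close>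

text \<open>The implicit form, with the newest value on the right. Moving it to the left costs a factor
  \<open>1 / (1 - x) \<le> exp (2 * x)\<close> per step, which is where \<open>x \<le> 1 / 2\<close> enters.\<close>

lemma discrete_gronwall:
  fixes z :: "nat \<Rightarrow> real"
  assumes nonneg: "\<And>n. n \<le> N \<Longrightarrow> 0 \<le> z n" and x: "0 \<le> x" "x \<le> 1 / 2"
    and step: "\<And>n. n < N \<Longrightarrow> z (Suc n) \<le> z n + x * z (Suc n)" and "n \<le> N"
  shows "z n \<le> exp (2 * x * real n) * z 0"
  using \<open>n \<le> N\<close>
proof (induction n)
  case (Suc n)
  have "1 \<le> (1 + 2 * x) * (1 - x)"
    using x mult_left_mono[of x "1 / 2" x] by (simp add: algebra_simps)
  also have "\<dots> \<le> exp (2 * x) * (1 - x)"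
    using x exp_ge_add_one_self[of "2 * x"] by (intro mult_right_mono) auto
  finally have "1 * z (Suc n) \<le> exp (2 * x) * (1 - x) * z (Suc n)"
    using nonneg[of "Suc n"] Suc.prems by (intro mult_right_mono) auto
  also have "\<dots> = exp (2 * x) * ((1 - x) * z (Suc n))" by simp
  also have "\<dots> \<le> exp (2 * x) * z n"
    using step[of n] Suc.prems by (intro mult_left_mono) (auto simp: algebra_simps)
  also have "\<dots> \<le> exp (2 * x) * (exp (2 * x * real n) * z 0)"
    using Suc by (intro mult_left_mono) auto
  also have "\<dots> = exp (2 * x * real (Suc n)) * z 0"
    by (simp add: distrib_left mult_exp_exp add.commute flip: mult.assoc)
  finally show ?case by simp
qed simp

text \<open>A pointwise bound of \<open>v\<close> by its own discrete \<open>\<ell>\<^sup>p\<close> norm up to the same index is a Gronwall inequality for the \<open>p\<close>-th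
  power \<open>y\<close> of that norm: \<open>y\<close> grows by \<open>\<tau> * norm (v n) powr p\<close>. The summand \<open>\<sigma>\<close> is treated as an initial value
  \<open>s\<close> added to \<open>y\<close>, normalised such that both terms carry the same constant.\<close>

lemma lp_gronwall:
  fixes v :: "nat \<Rightarrow> 'x::real_normed_vector"
  assumes "0 < p" "0 < \<kappa>" "0 < \<sigma>" "0 < \<tau>" "0 < A"
    and bound: "\<And>n. 1 \<le> n \<Longrightarrow> n \<le> N \<Longrightarrow> norm (v n) \<le> A * (\<kappa> * seq_lp_norm \<tau> p n v + \<sigma>)"
    and small: "\<tau> * (2 * A * \<kappa>) powr p \<le> 1 / 2" and "n \<le> N"
  shows "seq_lp_norm \<tau> p n v \<le> exp (2 * (2 * A * \<kappa>) powr p * (\<tau> * real N) / p) * (\<sigma> / \<kappa>)"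
proof -
  define y where "y n = (\<Sum>j=1..n. \<tau> * norm (v j) powr p)" for n
  define L where "L = (2 * A * \<kappa>) powr p"
  define s where "s = (\<sigma> / \<kappa>) powr p"
  have Y: "seq_lp_norm \<tau> p n v = y n powr (1 / p)" for n by (simp add: seq_lp_norm_def y_def)
  have y0: "0 \<le> y n" for n using assms(4) by (auto simp: y_def intro!: sum_nonneg)
  have s: "0 < s" and L: "0 < L" using assms by (simp_all add: s_def L_def)
  have incr: "norm (v n) powr p \<le> L * (y n + s)" if n: "1 \<le> n" "n \<le> N" for n
  proof -
    \<comment> \<open>The factor \<open>2\<close> in \<open>L\<close> comes from estimating a sum of two terms by twice their maximum \<open>m\<close>.\<close>
    define m where "m = max (y n powr (1 / p)) (\<sigma> / \<kappa>)"
    have m: "0 < m" "m powr p \<le> y n + s"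
      using assms(1-3) y0[of n] s by (auto simp: m_def max_def powr_powr s_def less_max_iff_disj)
    have "norm (v n) \<le> A * (\<kappa> * y n powr (1 / p) + \<sigma>)"
      using bound[OF n] by (simp add: Y)
    also have "\<dots> = A * \<kappa> * (y n powr (1 / p) + \<sigma> / \<kappa>)"
      using assms(2) by (simp add: field_simps)
    also have "\<dots> \<le> A * \<kappa> * (2 * m)"
      using assms(2,5) by (intro mult_left_mono) (auto simp: m_def)
    finally have "norm (v n) powr p \<le> (2 * A * \<kappa> * m) powr p"
      using assms(1) by (intro powr_mono2) (auto simp: mult_ac)
    also have "\<dots> = L * m powr p" using assms m by (simp add: L_def powr_mult)
    also have "\<dots> \<le> L * (y n + s)" using m L by simp
    finally show ?thesis .
  qed
  have "y n + s \<le> exp (2 * (\<tau> * L) * real n) * (y 0 + s)"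
  proof (rule discrete_gronwall[where N = N and z = "\<lambda>n. y n + s"])
    fix n assume "n < N"
    then have "\<tau> * norm (v (Suc n)) powr p \<le> \<tau> * (L * (y (Suc n) + s))"
      using assms(4) by (intro mult_left_mono incr) auto
    then show "y (Suc n) + s \<le> y n + s + \<tau> * L * (y (Suc n) + s)"
      by (simp add: y_def mult.assoc)
  qed (use y0 s L assms in \<open>auto simp: L_def add_nonneg_nonneg less_imp_le\<close>)
  also have "\<dots> = exp (2 * L * (\<tau> * real n)) * s" by (simp add: y_def mult_ac)
  also have "\<dots> \<le> exp (2 * L * (\<tau> * real N)) * s"
    using assms(4) L s \<open>n \<le> N\<close> by (intro mult_right_mono) auto
  finally have "y n \<le> exp (2 * L * (\<tau> * real N)) * s" using s by linarith
  then have "y n powr (1 / p) \<le> (exp (2 * L * (\<tau> * real N)) * s) powr (1 / p)"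
    using y0 assms(1) by (intro powr_mono2) auto
  also have "\<dots> = exp (2 * L * (\<tau> * real N) / p) * (\<sigma> / \<kappa>)"
    using assms(1-3) by (simp add: powr_mult s_def powr_powr exp_powr_real)
  finally show ?thesis by (simp add: Y L_def)
qed

section \<open>The fractional Gronwall inequality\<close>

theorem theorem2p6:
  fixes \<alpha> p \<kappa> T :: real
  assumes "umd_space TYPE('x::banach)"
    and "0 < \<alpha>" "\<alpha> < 1" and "1 / \<alpha> < p"
    and "0 < \<kappa>" and "0 < T"
  shows "\<exists>c>0. \<exists>\<tau>\<^sub>0>0. \<forall>(K :: nat \<Rightarrow> real) (\<sigma> :: real) (N :: nat) (\<tau> :: real) (v :: nat \<Rightarrow> 'x).
    scheme_weights \<alpha> K \<longrightarrow> 0 < \<sigma> \<longrightarrow> 1 \<le> N \<longrightarrow> \<tau> = T / real N \<longrightarrow> \<tau> < \<tau>\<^sub>0 \<longrightarrow> v 0 = 0 \<longrightarrow>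
    (\<forall>m. 1 \<le> m \<and> m \<le> N \<longrightarrow>
      seq_lp_norm \<tau> p m (frac_diff K \<alpha> \<tau> v) \<le> \<kappa> * seq_lp_norm \<tau> p m v + \<sigma>) \<longrightarrow>
    seq_linf_norm N v + seq_lp_norm \<tau> p N (frac_diff K \<alpha> \<tau> v) \<le> c * \<sigma>"
proof -
  obtain C where C: "0 < C" "\<And>K. scheme_weights \<alpha> K \<Longrightarrow>
      \<exists>b. Abs_fps b * Abs_fps K = 1 \<and> (\<forall>n. \<bar>b n\<bar> \<le> C * real (Suc n) powr (\<alpha> - 1))"
    using scheme_inverse_weights_bound[OF assms(2,3)] by blast
  have "1 < 1 / \<alpha>" using assms(2,3) by simp
  then have p: "1 < p" "1 < \<alpha> * p"
    using assms(2,4) by (linarith, simp add: divide_less_eq mult.commute)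
  define \<gamma> where "\<gamma> = (\<alpha> * p - 1) / (p - 1)"
  define A where "A = C * \<gamma> powr (- (1 - 1 / p)) * T powr (\<alpha> - 1 / p)"
  define L where "L = (2 * A * \<kappa>) powr p"
  define E where "E = exp (2 * L * T / p)"
  have \<gamma>: "0 < \<gamma>" using p by (simp add: \<gamma>_def)
  have A: "0 < A" using C(1) \<gamma> assms(6) by (simp add: A_def)
  have L: "0 < L" using A assms(5) by (simp add: L_def)
  have E: "0 < E" by (simp add: E_def)
  show ?thesis
  proof (rule exI[of _ "(A + 1) * (E + 1)"], intro conjI, use A E in simp,
      rule exI[of _ "1 / (2 * L)"], intro conjI allI impI, use L in simp)
    fix K \<sigma> N \<tau> and v :: "nat \<Rightarrow> 'x"
    assume K: "scheme_weights \<alpha> K" and \<sigma>: "0 < \<sigma>" and N: "1 \<le> N" and \<tau>: "\<tau> = T / real N"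
      and \<tau>_small: "\<tau> < 1 / (2 * L)" and v0: "v 0 = 0"
      and hyp: "\<forall>m. 1 \<le> m \<and> m \<le> N \<longrightarrow>
        seq_lp_norm \<tau> p m (frac_diff K \<alpha> \<tau> v) \<le> \<kappa> * seq_lp_norm \<tau> p m v + \<sigma>"
    define f where "f = frac_diff K \<alpha> \<tau> v"
    have \<tau>N: "\<tau> * real N = T" and \<tau>0: "0 < \<tau>" using \<tau> N assms(6) by auto
    obtain b where b: "Abs_fps b * Abs_fps K = 1" "\<And>n. \<bar>b n\<bar> \<le> C * real (Suc n) powr (\<alpha> - 1)"
      using C(2)[OF K] by blast
    have v_le_f: "norm (v n) \<le> A * seq_lp_norm \<tau> p n f" if "n \<le> N" for n
    proof -
      have "norm (v n) \<le> C * \<gamma> powr (- (1 - 1 / p)) * (\<tau> * real n) powr (\<alpha> - 1 / p) * seq_lp_norm \<tau> p n f"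
        unfolding \<gamma>_def f_def by (rule sup_le_frac_diff_lp) (use assms C(1) \<tau>0 v0 b in auto)
      also have "\<dots> \<le> C * \<gamma> powr (- (1 - 1 / p)) * T powr (\<alpha> - 1 / p) * seq_lp_norm \<tau> p n f"
        using that \<tau>0 C(1) p assms(2) unfolding \<tau>N[symmetric]
        by (intro mult_right_mono mult_left_mono powr_mono2) (auto simp: seq_lp_norm_def field_simps)
      finally show ?thesis by (simp add: A_def)
    qed
    have f_le_v: "seq_lp_norm \<tau> p n f \<le> \<kappa> * seq_lp_norm \<tau> p n v + \<sigma>" if "1 \<le> n" "n \<le> N" for n
      using hyp that by (simp add: f_def)
    have v_lp: "seq_lp_norm \<tau> p n v \<le> E * (\<sigma> / \<kappa>)" if "n \<le> N" for n
      unfolding E_def L_def \<tau>N[symmetric]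
    proof (rule lp_gronwall[OF _ _ _ _ A])
      fix n assume n: "1 \<le> n" "n \<le> N"
      have "A * seq_lp_norm \<tau> p n f \<le> A * (\<kappa> * seq_lp_norm \<tau> p n v + \<sigma>)"
        using f_le_v[OF n] A by simp
      with v_le_f[OF n(2)] show "norm (v n) \<le> A * (\<kappa> * seq_lp_norm \<tau> p n v + \<sigma>)"
        by (rule order.trans)
    next
      show "\<tau> * (2 * A * \<kappa>) powr p \<le> 1 / 2"
        using \<tau>_small L unfolding L_def[symmetric] by (simp add: field_simps)
    qed (use p assms \<sigma> \<tau>0 that in auto)
    have f_lp: "seq_lp_norm \<tau> p n f \<le> (E + 1) * \<sigma>" if n: "1 \<le> n" "n \<le> N" for n
    proof -
      have "\<kappa> * seq_lp_norm \<tau> p n v \<le> \<kappa> * (E * (\<sigma> / \<kappa>))"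
        using v_lp[OF n(2)] assms(5) by (intro mult_left_mono) auto
      with f_le_v[OF n] assms(5) show ?thesis by (simp add: algebra_simps)
    qed
    have "norm (v n) \<le> A * ((E + 1) * \<sigma>)" if "n \<in> {1..N}" for n
      using order.trans[OF v_le_f mult_left_mono[OF f_lp]] that A by auto
    then have "seq_linf_norm N v \<le> A * ((E + 1) * \<sigma>)"
      using N by (auto simp: seq_linf_norm_def)
    with f_lp[of N] N show "seq_linf_norm N v + seq_lp_norm \<tau> p N (frac_diff K \<alpha> \<tau> v) \<le> (A + 1) * (E + 1) * \<sigma>"
      by (simp add: f_def algebra_simps)
  qed
qed

end
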